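(* Let $X$ be a non-empty set, let $S,T\subseteq\mathrm{Der}(X)$ be non-empty, let $\Gamma=\overrightarrow{\mathrm{DA}}(X,S)$ and $\Delta=\overrightarrow{\mathrm{DA}}(X,T)$, and let $g\in\mathrm{Sym}(X)$. (a) Then $g$ is an isomorphism from $\Gamma$ to $\Delta$ if and only if $x^{S^g}=x^T$ for all $x\in X$. (b) $\mathrm{Aut}(\Gamma)=\{h\in\mathrm{Sym}(X) : x^S=x^{S^h}\text{ for all } x\in X\}$, and in particular $\mathrm{Aut}(\Gamma)$ contains $N_{\mathrm{Sym}(X)}(S)=\{h\in\mathrm{Sym}(X): S^h=S\}$.
   Context: For a set $X$, $\mathrm{Sym}(X)$ is the group of all permutations of $X$, acting on the right: $x^s$ is the image of $x$ under $s$, and $x^{st}=(x^s)^t$. A derangement of $X$ is a permutation of $X$ with no fixed points; $\mathrm{Der}(X)$ is the set of derangements of $X$. For $S\subseteq\mathrm{Sym}(X)$, $g\in\mathrm{Sym}(X)$ and $x\in X$, write $S^g=g^{-1}Sg=\{g^{-1}sg: s\in S\}$ and $x^S=\{x^s: s\in S\}$. A simple digraph is a pair $(X,A)$ with vertex set $X$ and arc set $A\subseteq\{(u,v): u,v\in X, u\neq v\}$. For non-empty $X$ and non-empty $S\subseteq \mathrm{Der}(X)$, the derangement action digraph $\overrightarrow{\mathrm{DA}}(X,S)$ is the simple digraph with vertex set $X$ and arc set $\{(x,x^s): x\in X, s\in S\}$. For simple digraphs $(X,A)$ and $(X,B)$ on the same vertex set, an isomorphism from $(X,A)$ to $(X,B)$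 is an element $g\in\mathrm{Sym}(X)$ with $A^g=B$, where $A^g=\{(u^g,v^g): (u,v)\in A\}$. An automorphism is an isomorphism from a digraph to itself, and $\mathrm{Aut}(\Gamma)$ is the group of automorphisms of $\Gamma$. *)

theory Defs
  imports
    "HOL-Algebra.Group"
    "HOL-Combinatorics.Permutations"
    "Graph_Theory.Pair_Digraph"
begin

text \<open>
  A permutation of \<open>X\<close> is a function that permutes \<open>X\<close> and is the identity off \<open>X\<close>; \<open>X\<close> may be
  infinite. Permutations act on the right: \<open>x\<^sup>s\<close> is \<open>s x\<close>, so the product \<open>s t\<close> is \<open>t \<circ> s\<close>
  (first \<open>s\<close>, then \<open>t\<close>), the opposite of the order used in HOL-Algebra for \<open>sym_group\<close> and
  \<open>BijGroup\<close>.
\<close>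

definition Sym :: "'a set \<Rightarrow> ('a \<Rightarrow> 'a) monoid" where
  "Sym X = \<lparr>carrier = {s. s permutes X}, monoid.mult = (\<lambda>s t. t \<circ> s), one = id\<rparr>"

lemma group_Sym: "group (Sym X)"
  by (rule groupI)
     (auto simp: Sym_def permutes_compose permutes_id o_assoc
       intro!: exI[of _ "Hilbert_Choice.inv _"] permutes_inv permutes_inv_o)

definition Der :: "'a set \<Rightarrow> ('a \<Rightarrow> 'a) set" where
  "Der X = {s \<in> carrier (Sym X). \<forall>x\<in>X. s x \<noteq> x}"

text \<open>\<open>conj_set G S g\<close> is \<open>S\<^sup>g = g\<^sup>-\<^sup>1 S g\<close>, and \<open>pt_image x S\<close> is \<open>x\<^sup>S\<close>.\<close>

definition conj_set :: "('g, 'm) monoid_scheme \<Rightarrow> 'g set \<Rightarrow> 'g \<Rightarrow> 'g set" where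
  "conj_set G S g = {inv\<^bsub>G\<^esub> g \<otimes>\<^bsub>G\<^esub> s \<otimes>\<^bsub>G\<^esub> g | s. s \<in> S}"

definition pt_image :: "'a \<Rightarrow> ('a \<Rightarrow> 'a) set \<Rightarrow> 'a set" where
  "pt_image x S = {s x | s. s \<in> S}"

definition set_normalizer :: "('g, 'm) monoid_scheme \<Rightarrow> 'g set \<Rightarrow> 'g set" where
  "set_normalizer G S = {h \<in> carrier G. conj_set G S h = S}"

definition DA :: "'a set \<Rightarrow> ('a \<Rightarrow> 'a) set \<Rightarrow> 'a pair_pre_digraph" where
  "DA X S = \<lparr>pverts = X, parcs = {(x, s x) | x s. x \<in> X \<and> s \<in> S}\<rparr>"

lemma pair_loopfree_digraph_DA:
  assumes "S \<subseteq> Der X"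
  shows "pair_loopfree_digraph (DA X S)"
proof
  fix e assume e: "e \<in> parcs (DA X S)"
  then obtain x s where xs: "e = (x, s x)" "x \<in> X" "s \<in> S"
    by (auto simp: DA_def)
  with assms have s: "s permutes X" "s x \<noteq> x"
    by (auto simp: Der_def Sym_def)
  show "fst e \<in> pverts (DA X S)" "snd e \<in> pverts (DA X S)" "fst e \<noteq> snd e"
    using xs s permutes_in_image[OF s(1)] by (auto simp: DA_def)
qed

text \<open>Isomorphisms are only considered between digraphs on the same vertex set.\<close>

definition is_digraph_isom :: "('a \<Rightarrow> 'a) \<Rightarrow> 'a pair_pre_digraph \<Rightarrow> 'a pair_pre_digraph \<Rightarrow> bool" where
  "is_digraph_isom g \<Gamma> \<Delta> \<longleftrightarrow>
     pverts \<Gamma> = pverts \<Delta> \<and> g \<in> carrier (Sym (pverts \<Gamma>)) \<and>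
     {(g u, g v) | u v. (u, v) \<in> parcs \<Gamma>} = parcs \<Delta>"

definition Aut :: "'a pair_pre_digraph \<Rightarrow> ('a \<Rightarrow> 'a) monoid" where
  "Aut \<Gamma> = (Sym (pverts \<Gamma>))\<lparr>carrier := {h. is_digraph_isom h \<Gamma> \<Gamma>}\<rparr>"

lemma group_Aut: "group (Aut \<Gamma>)"
proof (rule groupI)
  fix g assume "g \<in> carrier (Aut \<Gamma>)"
  then have g: "g permutes pverts \<Gamma>" and A: "{(g u, g v) | u v. (u, v) \<in> parcs \<Gamma>} = parcs \<Gamma>"
    by (auto simp: Aut_def Sym_def is_digraph_isom_def)
  let ?h = "Hilbert_Choice.inv g"
  have hg: "?h (g x) = x" for x
    using permutes_inverses(2)[OF g] .
  have "{(?h u, ?h v) | u v. (u, v) \<in> parcs \<Gamma>} = parcs \<Gamma>"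
  proof (intro equalityI subsetI)
    fix e assume "e \<in> {(?h u, ?h v) | u v. (u, v) \<in> parcs \<Gamma>}"
    then obtain u v where e: "e = (?h u, ?h v)" "(u, v) \<in> parcs \<Gamma>"
      by blast
    then have "(u, v) \<in> {(g u, g v) | u v. (u, v) \<in> parcs \<Gamma>}"
      unfolding A by simp
    then show "e \<in> parcs \<Gamma>"
      using e hg by auto
  next
    fix e assume "e \<in> parcs \<Gamma>"
    moreover obtain u v where e: "e = (u, v)"
      by fastforce
    ultimately have "(g u, g v) \<in> parcs \<Gamma>"
      using A by blast
    moreover have "e = (?h (g u), ?h (g v))"
      using e hg by simp
    ultimately show "e \<in> {(?h u, ?h v) | u v. (u, v) \<in> parcs \<Gamma>}"
      by blast
  qed
  then show "\<exists>h\<in>carrier (Aut \<Gamma>). h \<otimes>\<^bsub>Aut \<Gamma>\<^esub> g = \<one>\<^bsub>Aut \<Gamma>\<^esub>"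
    using g by (intro bexI[of _ ?h])
      (auto simp: Aut_def Sym_def is_digraph_isom_def permutes_inv permutes_inv_o)
next
  fix g h assume "g \<in> carrier (Aut \<Gamma>)" "h \<in> carrier (Aut \<Gamma>)"
  then have p: "g permutes pverts \<Gamma>" "h permutes pverts \<Gamma>"
    and A: "{(g u, g v) | u v. (u, v) \<in> parcs \<Gamma>} = parcs \<Gamma>"
    and B: "{(h u, h v) | u v. (u, v) \<in> parcs \<Gamma>} = parcs \<Gamma>"
    by (auto simp: Aut_def Sym_def is_digraph_isom_def)
  have "{(h (g u), h (g v)) | u v. (u, v) \<in> parcs \<Gamma>}
      = {(h u, h v) | u v. (u, v) \<in> {(g u, g v) | u v. (u, v) \<in> parcs \<Gamma>}}"
    by blast
  also have "\<dots> = parcs \<Gamma>"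
    unfolding A B ..
  finally show "g \<otimes>\<^bsub>Aut \<Gamma>\<^esub> h \<in> carrier (Aut \<Gamma>)"
    using p by (simp add: Aut_def Sym_def is_digraph_isom_def permutes_compose)
qed (auto simp: Aut_def Sym_def is_digraph_isom_def permutes_id o_assoc)

end

theory Submission
  imports Defs
begin

text \<open>
  Conjugating the connection set by \<open>g\<close> is the same as moving the arcs by \<open>g\<close>, and the
  out-neighbourhood of \<open>x\<close> in a derangement action digraph is \<open>x\<^sup>S\<close>; a digraph is determined
  by its out-neighbourhoods.
\<close>

lemma inv_Sym:
  assumes "g \<in> carrier (Sym X)"
  shows "inv\<^bsub>Sym X\<^esub> g = Hilbert_Choice.inv g"
proof -
  have g: "g permutes X"
    using assms by (simp add: Sym_def)
  show ?thesis
    using g by (intro group.inv_equality[OF group_Sym])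
      (auto simp: Sym_def permutes_inv permutes_inv_o)
qed

text \<open>At \<open>g x\<close>, the conjugate of \<open>s\<close> by \<open>g\<close> first
  returns to \<open>x\<close>, then applies \<open>s\<close>, then \<open>g\<close>, and so ends at
  \<open>g (s x)\<close>.\<close>

lemma pt_image_conj_set:
  assumes "g \<in> carrier (Sym X)"
  shows "pt_image (g x) (conj_set (Sym X) S g) = g ` pt_image x S"
proof -
  have "g permutes X"
    using assms by (simp add: Sym_def)
  then have "Hilbert_Choice.inv g (g x) = x"
    by (rule permutes_inverses(2))
  \<comment> \<open>The product of \<open>Sym X\<close> applies its left factor first, so in terms
    of \<open>\<circ>\<close> the conjugate reads in reverse order.\<close>
  moreover have "conj_set (Sym X) S g = {g \<circ> (s \<circ> Hilbert_Choice.inv g) | s. s \<in> S}"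
    unfolding conj_set_def inv_Sym[OF assms] by (simp add: Sym_def)
  then have "conj_set (Sym X) S g = (\<lambda>s. g \<circ> (s \<circ> Hilbert_Choice.inv g)) ` S"
    by (simp only: Setcompr_eq_image)
  ultimately show ?thesis
    by (simp add: pt_image_def Setcompr_eq_image image_image)
qed

text \<open>In this form, two arc sets over \<open>X\<close> agree exactly when their fibres over
  every vertex of \<open>X\<close> agree.\<close>

lemma parcs_DA: "parcs (DA X S) = Sigma X (\<lambda>x. pt_image x S)"
  by (auto simp: DA_def pt_image_def)

lemma arcs_image_DA:
  assumes "g \<in> carrier (Sym X)"
  shows "{(g u, g v) | u v. (u, v) \<in> parcs (DA X S)} = parcs (DA X (conj_set (Sym X) S g))"
proof -
  have g: "g ` X = X"
    using assms by (simp add: Sym_def permutes_image)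
  have "{(g u, g v) | u v. (u, v) \<in> parcs (DA X S)} = (\<Union>u\<in>X. {g u} \<times> g ` pt_image u S)"
    unfolding parcs_DA by blast
  \<comment> \<open>Reindex by the new tail \<open>x = g u\<close>; as \<open>g\<close> maps
    \<open>X\<close> onto itself, the tails again range over all of \<open>X\<close>.\<close>
  also have "\<dots> = (\<Union>x\<in>g ` X. {x} \<times> pt_image x (conj_set (Sym X) S g))"
    by (simp add: pt_image_conj_set[OF assms])
  also have "\<dots> = parcs (DA X (conj_set (Sym X) S g))"
    unfolding g parcs_DA by blast
  finally show ?thesis .
qed

text \<open>By \<open>arcs_image_DA\<close>, being an isomorphism is an equality between the arc
  sets of two derangement action digraphs, which is then compared fibre by fibre.\<close>

lemma is_digraph_isom_DA_iff:
  assumes "g \<in> carrier (Sym X)"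
  shows "is_digraph_isom g (DA X S) (DA X T) \<longleftrightarrow>
    (\<forall>x\<in>X. pt_image x (conj_set (Sym X) S g) = pt_image x T)"
proof -
  have "pverts (DA X S) = X" "pverts (DA X T) = X"
    by (simp_all add: DA_def)
  then have "is_digraph_isom g (DA X S) (DA X T) \<longleftrightarrow>
      parcs (DA X (conj_set (Sym X) S g)) = parcs (DA X T)"
    using assms unfolding is_digraph_isom_def arcs_image_DA[OF assms] by simp
  then show ?thesis
    unfolding parcs_DA by blast
qed

lemma carrier_Aut_DA:
  "carrier (Aut (DA X S)) =
    {h \<in> carrier (Sym X). \<forall>x\<in>X. pt_image x S = pt_image x (conj_set (Sym X) S h)}"
proof -
  have "carrier (Aut (DA X S)) = {h \<in> carrier (Sym X). is_digraph_isom h (DA X S) (DA X S)}"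
    by (auto simp: Aut_def is_digraph_isom_def DA_def)
  then show ?thesis
    by (auto simp: is_digraph_isom_DA_iff)
qed

theorem theorem1p15:
  fixes X :: "'a set" and S T :: "('a \<Rightarrow> 'a) set" and g :: "'a \<Rightarrow> 'a"
  assumes "X \<noteq> {}"
    and "S \<subseteq> Der X" and "S \<noteq> {}"
    and "T \<subseteq> Der X" and "T \<noteq> {}"
    and "g \<in> carrier (Sym X)"
  shows "(is_digraph_isom g (DA X S) (DA X T) \<longleftrightarrow>
        (\<forall>x\<in>X. pt_image x (conj_set (Sym X) S g) = pt_image x T)) \<and>
      carrier (Aut (DA X S)) =
        {h \<in> carrier (Sym X). \<forall>x\<in>X. pt_image x S = pt_image x (conj_set (Sym X) S h)} \<and>
      set_normalizer (Sym X) S \<subseteq> carrier (Aut (DA X S))"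
  \<comment> \<open>For \<open>h\<close> in the normalizer the conjugate of \<open>S\<close> is
    \<open>S\<close> itself, so the condition describing automorphisms becomes reflexivity.\<close>
  using is_digraph_isom_DA_iff[OF assms(6)]
  by (auto simp: carrier_Aut_DA set_normalizer_def)

end
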